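(* There is no on-line algorithm with strict competitive ratio less than $\frac{7}{4}$ for the on-line coloring problem restricted to unit interval graphs with known proper interval representation. That is, for every on-line coloring algorithm $A$ for unit interval graphs presented together with a proper interval representation, the strict competitive ratio of $A$ is at least $\frac{7}{4}$.
   Context: A graph $G=(V,E)$ is an interval graph if there is a function $f$ assigning to each vertex $v\in V$ a closed interval $f(v)$ on the real line so that distinct vertices $u,v$ are adjacent if and only if $f(u)\cap f(v)\neq\emptyset$; $f$ is called an interval representation of $G$. If no interval is properly contained in any other interval, $f$ is called a proper interval representation and $G$ a proper interval graph. If every interval has unit length, $f$ is a unit interval representation and $G$ is a unit interval graph. An interval graph is a unit interval graph if and only if it is a proper interval graph. All graphs are finite. On-line coloring with known proper interval representation: the vertices $v_1,\dots,v_n$ of a unit interval graph $G$ are presented one at a time, each vertex $v_i$ being presented as its interval $f(v_i)$ in some proper interval representation $f$ of $G$. A (deterministic) on-line algorithm $A$ must immediately and irrevocably assign to $v_i$ a color different from the colors of all previously presented vertices adjacent to $v_i$ (i.e. whose intervals intersect $f(v_i)$). The color assigned to $v_i$ depends only on the intervals $f(v_1),\dots,f(v_i)$ presented so far (in their order) and on the colors already assigned to $v_1,\dots,v_{i-1}$. Let $\chi(G)$ denote the chromatic number of $G$, and let $\chi_A(G)$ denote the maximum number of colors used by $A$ on $G$ over all ways of presenting $G$ (all orderings of the vertices and all proper interval representations). The algorithm $A$ is strictly $\rho$-competitive if $\chi_A(G)\le \rho\cdot\chi(G)$ for every unit interval graph $G$. The strict competitive ratio of $A$ is $\inf\{\rho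 \mid A \text{ is strictly } \rho\text{-competitive}\}$ (taken to be $+\infty$ if there is no such $\rho$). *)

theory Defs
  imports Complex_Main "HOL-Library.Extended_Real" "Graph_Theory.Pair_Digraph"
begin

text \<open>
  Finite simple graphs are the instances of the locale \<^locale>\<open>pair_graph\<close>: finite, loop-free,
  symmetric, without parallel arcs. Adjacency of \<open>u\<close> and \<open>v\<close> is \<open>(u, v) \<in> parcs G\<close>.
\<close>

definition closed_interval :: "real set \<Rightarrow> bool" where
  "closed_interval I \<longleftrightarrow> (\<exists>a b. a \<le> b \<and> I = {a..b})"

definition interval_representation :: "'a pair_pre_digraph \<Rightarrow> ('a \<Rightarrow> real set) \<Rightarrow> bool" where
  "interval_representation G f \<longleftrightarrow>
     (\<forall>v\<in>pverts G. closed_interval (f v)) \<and>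
     (\<forall>u\<in>pverts G. \<forall>v\<in>pverts G. u \<noteq> v \<longrightarrow> ((u, v) \<in> parcs G \<longleftrightarrow> f u \<inter> f v \<noteq> {}))"

text \<open>Distinct vertices may have the same interval in a proper representation.\<close>

definition proper_interval_representation :: "'a pair_pre_digraph \<Rightarrow> ('a \<Rightarrow> real set) \<Rightarrow> bool" where
  "proper_interval_representation G f \<longleftrightarrow>
     interval_representation G f \<and> (\<forall>u\<in>pverts G. \<forall>v\<in>pverts G. \<not> f u \<subset> f v)"

definition unit_interval_representation :: "'a pair_pre_digraph \<Rightarrow> ('a \<Rightarrow> real set) \<Rightarrow> bool" where
  "unit_interval_representation G f \<longleftrightarrow>
     interval_representation G f \<and> (\<forall>v\<in>pverts G. \<exists>a. f v = {a..a + 1})"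

definition unit_interval_graph :: "'a pair_pre_digraph \<Rightarrow> bool" where
  "unit_interval_graph G \<longleftrightarrow> pair_graph G \<and> (\<exists>f. unit_interval_representation G f)"

definition chromatic_number :: "'a pair_pre_digraph \<Rightarrow> nat" where
  "chromatic_number G =
     (LEAST k. \<exists>c :: 'a \<Rightarrow> nat. c ` pverts G \<subseteq> {..<k} \<and> (\<forall>(u, v)\<in>parcs G. c u \<noteq> c v))"

text \<open>
  An algorithm receives the intervals presented so far, in order of presentation and including
  the current one as last element, together with the colors of all earlier vertices, and returns
  the color of the current vertex.
\<close>

type_synonym 'c online_algorithm = "real set list \<Rightarrow> 'c list \<Rightarrow> 'c"

text \<open>The colors given to the first \<open>n\<close> intervals of the sequence \<open>Is\<close>.\<close>

primrec prefix_colors :: "'c online_algorithm \<Rightarrow> real set list \<Rightarrow> nat \<Rightarrow> 'c list" where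
  "prefix_colors A Is 0 = []"
| "prefix_colors A Is (Suc n) =
     prefix_colors A Is n @ [A (take (Suc n) Is) (prefix_colors A Is n)]"

definition assigned_colors :: "'c online_algorithm \<Rightarrow> real set list \<Rightarrow> 'c list" where
  "assigned_colors A Is = prefix_colors A Is (length Is)"

definition presentation :: "'a pair_pre_digraph \<Rightarrow> ('a \<Rightarrow> real set) \<Rightarrow> 'a list \<Rightarrow> bool" where
  "presentation G f vs \<longleftrightarrow>
     proper_interval_representation G f \<and> distinct vs \<and> set vs = pverts G"

text \<open>
  Being finite, all graphs are taken with vertices in \<^typ>\<open>nat\<close>; the algorithm sees only the
  intervals, never the vertex names.
\<close>

definition online_coloring_algorithm :: "'c online_algorithm \<Rightarrow> bool" where
  "online_coloring_algorithm A \<longleftrightarrow>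
     (\<forall>(G :: nat pair_pre_digraph) f vs. unit_interval_graph G \<and> presentation G f vs \<longrightarrow>
        (\<forall>i < length vs. \<forall>j < i. (vs ! j, vs ! i) \<in> parcs G \<longrightarrow>
           assigned_colors A (map f vs) ! i \<noteq> assigned_colors A (map f vs) ! j))"

definition online_chromatic_number :: "'c online_algorithm \<Rightarrow> nat pair_pre_digraph \<Rightarrow> nat" where
  "online_chromatic_number A G =
     Max {card (set (assigned_colors A (map f vs))) | f vs. presentation G f vs}"

definition strictly_competitive :: "real \<Rightarrow> 'c online_algorithm \<Rightarrow> bool" where
  "strictly_competitive \<rho> A \<longleftrightarrow>
     (\<forall>G. unit_interval_graph G \<longrightarrow>
        real (online_chromatic_number A G) \<le> \<rho> * real (chromatic_number G))"

text \<open>The infimum over the empty set is \<open>\<infinity>\<close>.\<close>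

definition strict_competitive_ratio :: "'c online_algorithm \<Rightarrow> ereal" where
  "strict_competitive_ratio A = Inf {ereal \<rho> | \<rho>. strictly_competitive \<rho> A}"

lemma length_assigned_colors: "length (assigned_colors A Is) = length Is"
proof -
  have "length (prefix_colors A Is n) = n" for n
    by (induction n) auto
  then show ?thesis
    by (simp add: assigned_colors_def)
qed

lemma unit_imp_proper_interval_representation:
  assumes "unit_interval_representation G f"
  shows "proper_interval_representation G f"
proof -
  have "\<not> f u \<subset> f v" if uv: "u \<in> pverts G" "v \<in> pverts G" for u v
  proof -
    obtain a b where ab: "f u = {a..a + 1}" "f v = {b..b + 1}"
      using assms uv unfolding unit_interval_representation_def by blast
    have "a = b" if "{a..a + 1} \<subseteq> {b..b + 1}"
      using that by simp
    then show ?thesis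
      using ab by blast
  qed
  then show ?thesis
    using assms by (simp add: unit_interval_representation_def proper_interval_representation_def)
qed

text \<open>The maximum defining \<^const>\<open>online_chromatic_number\<close> is over a finite nonempty set.\<close>

lemma finite_color_counts:
  fixes A :: "'c online_algorithm" and G :: "nat pair_pre_digraph"
  shows "finite {card (set (assigned_colors A (map f vs))) | f vs. presentation G f vs}"
proof (rule finite_subset)
  show "{card (set (assigned_colors A (map f vs))) | f vs. presentation G f vs} \<subseteq> {..card (pverts G)}"
  proof clarify
    fix f vs assume "presentation G f vs"
    then have "length vs = card (pverts G)"
      by (metis presentation_def distinct_card)
    then show "card (set (assigned_colors A (map f vs))) \<le> card (pverts G)"
      by (metis card_length length_assigned_colors length_map)
  qed
qed simp

lemma nonempty_color_counts:
  fixes A :: "'c online_algorithm" and G :: "nat pair_pre_digraph"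
  assumes "unit_interval_graph G"
  shows "{card (set (assigned_colors A (map f vs))) | f vs. presentation G f vs} \<noteq> {}"
proof -
  obtain f where "proper_interval_representation G f"
    using assms unit_imp_proper_interval_representation unfolding unit_interval_graph_def by blast
  moreover obtain vs where "distinct vs" "set vs = pverts G"
    using assms finite_distinct_list pair_fin_digraph.pair_finite_verts
    unfolding unit_interval_graph_def pair_graph_def pair_digraph_def by metis
  ultimately show ?thesis
    by (auto simp: presentation_def)
qed

end

theory Submission
  imports Defs "HOL-Library.Sublist"
begin

text \<open>
  The adversary forces seven colours while keeping all cliques of size at most four. Read from left
  to right, the interval endpoints form a word labelled by colours; as the intervals are proper, they
  close in the order in which they open, so this word determines the adjacencies. A word from which
  seven colours can be forced keeps this property under mirroring, injective renaming of colours, and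
  the addition of separate components on either side. Up to these operations a winning
  strategy from the empty word passes through few positions only, and a table of them can be checked
  by evaluation. By density of the reals the abstract moves can be carried out with real intervals;
  numbering these from left to right, the indices modulo four are a proper colouring.
\<close>

section \<open>Words of endpoints\<close>

datatype 'c endpoint = is_left: Left (colour: 'c) | Right (colour: 'c)

definition lefts :: "'c endpoint list \<Rightarrow> 'c list" where
  "lefts w = map colour (filter is_left w)"

definition rights :: "'c endpoint list \<Rightarrow> 'c list" where
  "rights w = map colour (filter (\<lambda>e. \<not> is_left e) w)"

lemma lefts_simps [simp]:
  "lefts [] = []" "lefts (Left c # w) = c # lefts w" "lefts (Right c # w) = lefts w"
  "lefts (u @ v) = lefts u @ lefts v"
  by (simp_all add: lefts_def)

lemma rights_simps [simp]:
  "rights [] = []" "rights (Left c # w) = rights w" "rights (Right c # w) = c # rights w"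
  "rights (u @ v) = rights u @ rights v"
  by (simp_all add: rights_def)

lemma lefts_map [simp]: "lefts (map (map_endpoint f) w) = map f (lefts w)"
  by (induction w) (auto simp: lefts_def endpoint.map_sel endpoint.map_disc_iff)

lemma rights_map [simp]: "rights (map (map_endpoint f) w) = map f (rights w)"
  by (induction w) (auto simp: rights_def endpoint.map_sel endpoint.map_disc_iff)

lemma colour_map [simp]: "colour (map_endpoint f e) = f (colour e)"
  by (cases e) auto

definition colours :: "'c endpoint list \<Rightarrow> 'c set" where
  "colours w = colour ` set w"

lemma colours_simps [simp]:
  "colours [] = {}" "colours (e # w) = insert (colour e) (colours w)"
  "colours (u @ v) = colours u \<union> colours v" "finite (colours w)"
  "colours (map (map_endpoint f) w) = f ` colours w"
  by (auto simp: colours_def image_image)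

lemma map_endpoint_fun_upd:
  assumes "a \<notin> colours w"
  shows "map (map_endpoint (f(a := c))) w = map (map_endpoint f) w"
proof (rule map_cong[OF refl])
  fix e assume "e \<in> set w"
  then have "colour e \<noteq> a" using assms by (auto simp: colours_def)
  then show "map_endpoint (f(a := c)) e = map_endpoint f e" by (cases e) auto
qed

definition balanced :: "'c endpoint list \<Rightarrow> bool" where
  "balanced w \<longleftrightarrow> length (lefts w) = length (rights w)"

text \<open>
  A new interval opens between \<open>w1\<close> and \<open>w2\<close> and closes between \<open>w2\<close> and \<open>w3\<close>. The first condition
  keeps the representation proper: the intervals opening before the new one are those closing before
  it. The last condition keeps all cliques at size at most four.
\<close>

definition fits :: "'c endpoint list \<Rightarrow> 'c endpoint list \<Rightarrow> 'c endpoint list \<Rightarrow> bool" where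
  "fits w1 w2 w3 \<longleftrightarrow>
     length (lefts w1) = length (rights (w1 @ w2)) \<and> balanced (w1 @ w2 @ w3) \<and>
     (\<forall>u v. w2 = u @ v \<longrightarrow> length (lefts (w1 @ u)) \<le> length (rights (w1 @ u)) + 3)"

text \<open>Only the kinds of the endpoints enter \<open>fits\<close>, not their labels. Hence a
  move in a word labelled by colours is also a move in the same word labelled by interval
  indices.\<close>

lemma fits_map [simp]:
  "fits (map (map_endpoint f) w1) (map (map_endpoint f) w2) (map (map_endpoint f) w3) \<longleftrightarrow> fits w1 w2 w3"
proof -
  let ?m = "map (map_endpoint f)"
  have "(\<forall>u v. ?m w2 = u @ v \<longrightarrow> length (lefts (?m w1 @ u)) \<le> length (rights (?m w1 @ u)) + 3) \<longleftrightarrow>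
      (\<forall>u v. w2 = u @ v \<longrightarrow> length (lefts (w1 @ u)) \<le> length (rights (w1 @ u)) + 3)" (is "?L \<longleftrightarrow> ?R")
  proof
    assume L: ?L
    show ?R
    proof (intro allI impI)
      fix u v assume "w2 = u @ v"
      then have "?m w2 = ?m u @ ?m v" by simp
      with L have "length (lefts (?m w1 @ ?m u)) \<le> length (rights (?m w1 @ ?m u)) + 3" by blast
      then show "length (lefts (w1 @ u)) \<le> length (rights (w1 @ u)) + 3" by simp
    qed
  next
    assume R: ?R
    show ?L
    proof (intro allI impI)
      fix u v assume "?m w2 = u @ v"
      then obtain u' v' where "w2 = u' @ v'" "u = ?m u'"
        by (auto simp: map_eq_append_conv)
      moreover from this R have "length (lefts (w1 @ u')) \<le> length (rights (w1 @ u')) + 3" by blast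
      ultimately show "length (lefts (?m w1 @ u)) \<le> length (rights (?m w1 @ u)) + 3" by simp
    qed
  qed
  then show ?thesis by (simp add: fits_def balanced_def)
qed

text \<open>
  By properness, the intervals that meet the new one are those with an endpoint in \<open>w2\<close>.
\<close>

inductive forced :: "'c endpoint list \<Rightarrow> bool" where
  seven: "7 \<le> card (colours w) \<Longrightarrow> forced w"
| present: "fits w1 w2 w3 \<Longrightarrow>
    (\<And>c. c \<notin> colours w2 \<Longrightarrow> forced (w1 @ Left c # w2 @ Right c # w3)) \<Longrightarrow>
    forced (w1 @ w2 @ w3)"

section \<open>Closure of \<open>forced\<close> under contexts, reflection and renaming\<close>

text \<open>Balanced words on either side add equally to both sides of each comparison in
  \<open>fits\<close> and leave \<open>w2\<close>, hence the forbidden colours, unchanged. So a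
  strategy for one component still works in the presence of others.\<close>

lemma forced_context:
  assumes "forced w" "balanced p" "balanced s"
  shows "forced (p @ w @ s)"
  using assms(1)
proof induction
  case (seven w)
  have "card (colours w) \<le> card (colours (p @ w @ s))"
    by (rule card_mono) auto
  with seven show ?case
    by (intro forced.seven) linarith
next
  case (present w1 w2 w3)
  have "fits (p @ w1) w2 (w3 @ s)"
    using present.hyps(1) assms(2,3) by (auto simp: fits_def balanced_def)
  then have "forced ((p @ w1) @ w2 @ (w3 @ s))"
    by (rule forced.present) (use present.IH in auto)
  then show ?case by simp
qed

fun flip :: "'c endpoint \<Rightarrow> 'c endpoint" where
  "flip (Left c) = Right c"
| "flip (Right c) = Left c"

definition mirror :: "'c endpoint list \<Rightarrow> 'c endpoint list" where
  "mirror w = rev (map flip w)"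

lemma colour_flip [simp]: "colour (flip e) = colour e"
  by (cases e) auto

lemma mirror_simps [simp]:
  "mirror [] = []" "mirror (e # w) = mirror w @ [flip e]" "mirror (u @ v) = mirror v @ mirror u"
  "colours (mirror w) = colours w"
  by (auto simp: mirror_def colours_def image_image)

lemma flip_flip [simp]: "flip (flip e) = e"
  by (cases e) auto

lemma mirror_mirror [simp]: "mirror (mirror w) = w"
  by (simp add: mirror_def rev_map comp_def)

lemma length_mirror [simp]:
  "length (lefts (mirror w)) = length (rights w)"
  "length (rights (mirror w)) = length (lefts w)"
proof -
  have "length (lefts (mirror w)) = length (rights w) \<and> length (rights (mirror w)) = length (lefts w)"
  proof (induction w)
    case (Cons e w)
    then show ?case by (cases e) auto
  qed simp
  then show "length (lefts (mirror w)) = length (rights w)" "length (rights (mirror w)) = length (lefts w)"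
    by auto
qed

text \<open>Reflection swaps the roles of \<open>w1\<close> and \<open>w3\<close>. As the whole word
  is balanced, the surplus of left over right endpoints before a given place equals the surplus of
  right over left endpoints behind it, so the bound on open intervals survives.\<close>

lemma forced_mirror: "forced w \<Longrightarrow> forced (mirror w)"
proof (induction rule: forced.induct)
  case (seven w)
  then show ?case by (intro forced.seven) simp
next
  case (present w1 w2 w3)
  have "length (lefts (mirror w3 @ u)) \<le> length (rights (mirror w3 @ u)) + 3"
    if "mirror w2 = u @ v" for u v
  proof -
    have "w2 = mirror v @ mirror u"
      using that by (metis mirror_mirror mirror_simps(3))
    then show ?thesis
      using present.hyps(1) by (auto simp: fits_def balanced_def)
  qed
  then have "fits (mirror w3) (mirror w2) (mirror w1)"
    using present.hyps(1) by (auto simp: fits_def balanced_def)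
  then have "forced (mirror w3 @ mirror w2 @ mirror w1)"
    by (rule forced.present) (use present.IH in auto)
  then show ?case by simp
qed

lemma forced_rename:
  fixes w :: "nat endpoint list" and f :: "nat \<Rightarrow> 'c"
  assumes "forced w" "inj_on f (colours w)"
  shows "forced (map (map_endpoint f) w)"
  using assms
proof (induction arbitrary: f)
  case (seven w)
  then show ?case by (intro forced.seven) (simp add: card_image)
next
  case (present w1 w2 w3)
  let ?m = "map (map_endpoint f)"
  have "fits (?m w1) (?m w2) (?m w3)"
    using present.hyps(1) by (rule fits_map[THEN iffD2])
  moreover have "forced (?m w1 @ Left c # ?m w2 @ Right c # ?m w3)" if c: "c \<notin> colours (?m w2)" for c
  proof (cases "c \<in> f ` colours (w1 @ w2 @ w3)")
    case True
    then obtain a where a: "a \<in> colours (w1 @ w2 @ w3)" "c = f a" by blast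
    then have "a \<notin> colours w2" using c by auto
    moreover have "colours (w1 @ Left a # w2 @ Right a # w3) = colours (w1 @ w2 @ w3)"
      using a(1) by auto
    ultimately have "forced (map (map_endpoint f) (w1 @ Left a # w2 @ Right a # w3))"
      using present.IH present.prems by metis
    then show ?thesis by (simp add: a(2))
  next
    case False
    obtain a where a: "a \<notin> colours (w1 @ w2 @ w3)"
      using ex_new_if_finite[OF infinite_UNIV_nat] colours_simps(4) by blast
    let ?g = "f(a := c)"
    have inj: "inj_on ?g (colours (w1 @ Left a # w2 @ Right a # w3))"
      using present.prems a False by (auto simp: inj_on_def)
    have "forced (map (map_endpoint ?g) (w1 @ Left a # w2 @ Right a # w3))"
      by (rule present.IH[OF _ inj]) (use a in auto)
    then show ?thesis using a by (simp add: map_endpoint_fun_upd)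
  qed
  ultimately show ?case
    using forced.present[of "?m w1" "?m w2" "?m w3"] by simp
qed

section \<open>Executable strategies and their soundness\<close>

text \<open>
  \<open>Play i j ts\<close> presents an interval opening after the first \<open>i\<close> endpoints and closing after \<open>j\<close>
  more; \<open>ts\<close> lists the continuations for the possible colours in increasing order.
  \<open>Recall n i b\<close> refers to the \<open>n\<close>-th position of a table, mirrored if \<open>b\<close>, which occurs up to
  renaming of colours after the first \<open>i\<close> endpoints. Counting starts at \<open>0\<close>.
\<close>

datatype strategy = Play nat nat "strategy list" | Recall nat nat bool

text \<open>
  In the compact notation for words, \<open>Suc c\<close> opens an interval of colour \<open>c\<close> and \<open>0\<close> closes
  the interval that was opened first among those still open, whose colours are queued in the first
  argument.
\<close>

fun decode :: "nat list \<Rightarrow> nat list \<Rightarrow> nat endpoint list" where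
  "decode q [] = []"
| "decode q (Suc c # xs) = Left c # decode (q @ [c]) xs"
| "decode (c # q) (0 # xs) = Right c # decode q xs"
| "decode [] (0 # xs) = decode [] xs"

text \<open>An executable form of equality up to injective renaming: read from left to right, the
  equivalence says that corresponding colours form a function, and from right to left, that this
  function is injective.\<close>

definition renamed :: "nat endpoint list \<Rightarrow> nat endpoint list \<Rightarrow> bool" where
  "renamed u w \<longleftrightarrow> map is_left u = map is_left w \<and>
     (\<forall>(a, b)\<in>set (zip (map colour u) (map colour w)).
        \<forall>(a', b')\<in>set (zip (map colour u) (map colour w)). a = a' \<longleftrightarrow> b = b')"

text \<open>Truncation in \<open>h - 1\<close> can only overestimate the number of open intervals.\<close>

fun at_most_three_open :: "nat \<Rightarrow> nat endpoint list \<Rightarrow> bool" where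
  "at_most_three_open h [] \<longleftrightarrow> h \<le> 3"
| "at_most_three_open h (e # w) \<longleftrightarrow> h \<le> 3 \<and> at_most_three_open (if is_left e then Suc h else h - 1) w"

text \<open>
  The colours in use are \<open>{..<m}\<close>, and \<open>m\<close> stands for all unused ones. Once six colours are in use,
  an unused one is the seventh and needs no continuation.
\<close>

fun wins :: "nat list list \<Rightarrow> nat \<Rightarrow> strategy \<Rightarrow> nat endpoint list \<Rightarrow> bool" where
  "wins us m (Play i j ts) w =
     (let w1 = take i w; w2 = take j (drop i w); w3 = drop j (drop i w);
          cs = filter (\<lambda>c. c \<notin> colours w2) [0..<min 6 (Suc m)]
      in length (lefts w1) = length (rights (w1 @ w2)) \<and> balanced w \<and>
         at_most_three_open (length (lefts w1) - length (rights w1)) w2 \<and>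
         list_all2 (\<lambda>c t. wins us (if c = m then Suc m else m) t (w1 @ Left c # w2 @ Right c # w3)) cs ts)"
| "wins us m (Recall n i b) w =
     (n < length us \<and>
      (let u = decode [] (us ! n); u' = (if b then mirror u else u); v = take (length u) (drop i w)
       in renamed u' v \<and> balanced (take i w) \<and> balanced (drop (length u) (drop i w))))"

lemma at_most_three_openD:
  assumes "at_most_three_open h (u @ v)"
  shows "h + length (lefts u) \<le> length (rights u) + 3"
  using assms
proof (induction u arbitrary: h)
  case Nil
  then show ?case by (cases v) auto
next
  case (Cons e u)
  show ?case
  proof (cases e)
    case (Left c)
    then show ?thesis using Cons.IH[of "Suc h"] Cons.prems by simp
  next
    case (Right c)
    then show ?thesis using Cons.IH[of "h - 1"] Cons.prems by simp
  qed
qed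

text \<open>The renaming is recovered by choice from the zipped colours; then
  \<open>forced_rename\<close> applies.\<close>

lemma forced_renamed:
  assumes "renamed u w" "forced u"
  shows "forced w"
proof -
  let ?Z = "zip (map colour u) (map colour w)"
  have is_left: "map is_left u = map is_left w"
    using assms(1) unfolding renamed_def by blast
  then have len: "length u = length w"
    by (rule map_eq_imp_length_eq)
  have uniq: "a = a' \<longleftrightarrow> b = b'" if "(a, b) \<in> set ?Z" "(a', b') \<in> set ?Z" for a b a' b'
    using assms(1) that unfolding renamed_def by blast
  define f where "f a = (SOME b. (a, b) \<in> set ?Z)" for a
  have f: "f a = b" if "(a, b) \<in> set ?Z" for a b
  proof -
    have "(a, f a) \<in> set ?Z"
      unfolding f_def using that by (rule someI)
    then show ?thesis
      using uniq[OF _ that] by blast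
  qed
  have nth: "(colour (u ! i), colour (w ! i)) \<in> set ?Z" if "i < length u" for i
  proof -
    have "?Z ! i = (colour (u ! i), colour (w ! i))" "i < length ?Z"
      using that len by simp_all
    then show ?thesis by (metis nth_mem)
  qed
  have "map (map_endpoint f) u = w"
  proof (rule nth_equalityI)
    fix i assume i: "i < length (map (map_endpoint f) u)"
    then have "f (colour (u ! i)) = colour (w ! i)"
      using nth f by simp
    moreover have "is_left (u ! i) = is_left (w ! i)"
      using arg_cong[of _ _ "\<lambda>xs. xs ! i", OF is_left] i len by simp
    ultimately show "map (map_endpoint f) u ! i = w ! i"
      using i by (cases "u ! i"; cases "w ! i") auto
  qed (simp add: len)
  moreover have "inj_on f (colours u)"
  proof (rule inj_onI)
    fix a a' assume *: "a \<in> colours u" "a' \<in> colours u" "f a = f a'"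
    have "\<exists>b. (a, b) \<in> set ?Z" if "a \<in> colours u" for a
    proof -
      obtain i where "i < length u" "a = colour (u ! i)"
        using \<open>a \<in> colours u\<close> unfolding colours_def by (metis imageE in_set_conv_nth)
      then show ?thesis using nth by blast
    qed
    then obtain b b' where "(a, b) \<in> set ?Z" "(a', b') \<in> set ?Z"
      using * by blast
    then show "a = a'"
      using f uniq *(3) by metis
  qed
  ultimately show ?thesis
    using forced_rename[OF assms(2)] by metis
qed

lemma forced_presentI:
  fixes w1 w2 w3 :: "nat endpoint list"
  assumes "fits w1 w2 w3" and a: "a \<notin> colours (w1 @ w2 @ w3)"
    and "\<And>c. c \<in> insert a (colours (w1 @ w2 @ w3)) - colours w2 \<Longrightarrow> forced (w1 @ Left c # w2 @ Right c # w3)"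
  shows "forced (w1 @ w2 @ w3)"
proof (rule forced.present[OF assms(1)])
  fix c assume c: "c \<notin> colours w2"
  show "forced (w1 @ Left c # w2 @ Right c # w3)"
  proof (cases "c \<in> colours (w1 @ w2 @ w3)")
    case True
    then show ?thesis using assms(3) c by blast
  next
    case False
    let ?f = "id(a := c)"
    have "forced (w1 @ Left a # w2 @ Right a # w3)"
      using assms(3) a by auto
    moreover have "inj_on ?f (colours (w1 @ Left a # w2 @ Right a # w3))"
      using False a by (auto simp: inj_on_def)
    ultimately have "forced (map (map_endpoint ?f) (w1 @ Left a # w2 @ Right a # w3))"
      by (rule forced_rename)
    then show ?thesis using a by (simp add: map_endpoint_fun_upd endpoint.map_id0)
  qed
qed

text \<open>Induction along the check, with the invariant that the colours in use are exactly
  \<open>{..<m}\<close>. A \<open>Play\<close> is a move of the game; a \<open>Recall\<close> is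
  settled by the closure of \<open>forced\<close> under reflection, renaming and balanced
  contexts.\<close>

lemma wins_forced:
  assumes "wins us m t w" "colours w = {..<m}" "\<And>u. u \<in> set us \<Longrightarrow> forced (decode [] u)"
  shows "forced w"
  using assms
proof (induction us m t w rule: wins.induct)
  case (1 us m i j ts w)
  define w1 w2 w3 where w: "w1 = take i w" "w2 = take j (drop i w)" "w3 = drop j (drop i w)"
  define cs where "cs = filter (\<lambda>c. c \<notin> colours w2) [0..<min 6 (Suc m)]"
  have split: "w = w1 @ w2 @ w3" unfolding w by (metis append_take_drop_id)
  have wins: "length (lefts w1) = length (rights (w1 @ w2))" "balanced w"
    "at_most_three_open (length (lefts w1) - length (rights w1)) w2"
    "list_all2 (\<lambda>c t. wins us (if c = m then Suc m else m) t (w1 @ Left c # w2 @ Right c # w3)) cs ts"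
    using 1(2) unfolding wins.simps Let_def w[symmetric] cs_def[symmetric] by blast+
  have "fits w1 w2 w3"
    unfolding fits_def
  proof (intro conjI allI impI)
    fix u v assume "w2 = u @ v"
    then show "length (lefts (w1 @ u)) \<le> length (rights (w1 @ u)) + 3"
      using at_most_three_openD[of "length (lefts w1) - length (rights w1)" u v] wins(1,3) by simp
  qed (use wins(1,2) in \<open>simp_all add: split\<close>)
  moreover have "m \<notin> colours (w1 @ w2 @ w3)"
    using 1(3) split by simp
  moreover have "forced (w1 @ Left c # w2 @ Right c # w3)"
    if c: "c \<in> insert m (colours (w1 @ w2 @ w3)) - colours w2" for c
  proof -
    define m' where "m' = (if c = m then Suc m else m)"
    define w' where "w' = w1 @ Left c # w2 @ Right c # w3"
    have "colours w' = insert c (colours w)"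
      by (auto simp: w'_def split)
    then have "colours w' = insert c {..<m}"
      using 1(3) by simp
    moreover have "c \<in> insert m {..<m}" "c \<notin> colours w2"
      using c 1(3) split by (metis DiffD1, metis DiffD2)
    then have c_le: "c \<le> m" "c \<notin> colours w2" by auto
    ultimately have colours: "colours w' = {..<m'}"
      by (cases "c = m") (simp_all add: m'_def lessThan_Suc insert_absorb)
    show "forced w'"
    proof (cases "c < 6")
      case True
      then have cs: "c \<in> set cs"
        unfolding cs_def set_filter set_upt using c_le by simp
      then obtain k where k: "k < length cs" "cs ! k = c"
        by (metis in_set_conv_nth)
      have "wins us m' (ts ! k) w'" "ts ! k \<in> set ts"
        using list_all2_nthD[OF wins(4) k(1)] list_all2_lengthD[OF wins(4)] k
        by (simp_all add: m'_def w'_def)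
      then show ?thesis
        using 1(1)[OF w cs_def cs, of "ts ! k"] colours 1(4) unfolding m'_def w'_def by simp
    next
      \<comment> \<open>The colours now in use form an initial segment \<open>{..<m'}\<close>
        containing \<open>c\<close>, so \<open>c \<ge> 6\<close> means that there are at least
        seven.\<close>
      case False
      then have "7 \<le> card (colours w')"
        using c_le by (simp add: colours m'_def)
      then show ?thesis by (rule forced.seven)
    qed
  qed
  ultimately show ?case
    unfolding split by (rule forced_presentI)
next
  case (2 us m n i b w)
  define u where "u = decode [] (us ! n)"
  have wins: "n < length us" "renamed (if b then mirror u else u) (take (length u) (drop i w))"
    "balanced (take i w)" "balanced (drop (length u) (drop i w))"
    using 2(1) unfolding wins.simps Let_def u_def[symmetric] by blast+
  have "forced (if b then mirror u else u)"
    using 2 wins(1) by (auto simp: u_def forced_mirror)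
  then have "forced (take (length u) (drop i w))"
    using wins(2) forced_renamed by blast
  then have "forced (take i w @ take (length u) (drop i w) @ drop (length u) (drop i w))"
    using wins(3,4) by (rule forced_context)
  then show ?case by (simp only: append_take_drop_id)
qed

text \<open>The list \<open>us\<close> holds the positions certified so far, so a row can recall
  only rows above it and no circularity arises. Appending at the end keeps the row numbers
  fixed.\<close>

fun certified :: "nat list list \<Rightarrow> (nat list \<times> strategy) list \<Rightarrow> bool" where
  "certified us [] \<longleftrightarrow> True"
| "certified us ((u, t) # ts) \<longleftrightarrow>
     (let w = decode [] u; m = card (colours w)
      in colours w = {..<m} \<and> wins us m t w \<and> certified (us @ [u]) ts)"

lemma certified_forced:
  assumes "certified us ts" "\<And>u. u \<in> set us \<Longrightarrow> forced (decode [] u)" "u \<in> fst ` set ts"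
  shows "forced (decode [] u)"
  using assms
proof (induction us ts rule: certified.induct)
  case (2 us v t ts)
  have v: "forced (decode [] v)"
    using 2(2,3) wins_forced[of us "card (colours (decode [] v))" t "decode [] v"] by (simp add: Let_def)
  moreover have "forced (decode [] u)" if "u \<in> fst ` set ts"
    using 2(1)[OF refl refl _ _ that] 2(2,3) v by (auto simp: Let_def)
  ultimately show ?case using 2(4) by auto
qed simp

text \<open>Found by computer search. The last entry is the empty position.\<close>

definition strategies :: "(nat list \<times> strategy) list" where
  "strategies = [
    ([1,2,3,0,0,0,4,5,1,3,0,0,0,0], Play 3 5 [Play 5 6 []]),
    ([1,2,3,0,0,0,4,5,1,3,0,0,4,0,0,0], Play 3 5 [Play 5 6 []]),
    ([1,2,3,0,0,4,0,5,1,0,2,3,0,0,0,0], Play 6 5 [Play 3 6 []]),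
    ([1,2,3,0,0,4,0,5,1,2,0,3,0,0,0,0], Play 3 5 [Play 5 6 []]),
    ([1,2,3,0,0,4,0,5,1,2,0,3,0,0,4,1,0,0,0,0], Play 3 5 [Play 5 6 []]),
    ([1,2,3,0,0,4,0,5,1,2,0,3,0,0,4,5,0,0,0,0], Play 3 5 [Play 5 6 []]),
    ([1,2,3,0,0,4,0,5,1,2,0,3,0,0,4,6,0,0,0,0], Play 3 5 [Play 5 6 []]),
    ([1,2,3,0,0,4,0,5,1,3,0,2,0,0,0,0], Play 3 5 [Play 5 6 []]),
    ([1,2,3,0,0,4,0,5,1,3,0,2,0,0,4,0,0,0], Play 3 5 [Play 5 6 []]),
    ([1,2,3,0,4,0,0,5,0,2,1,3,0,4,0,0,0,0], Play 3 5 [Play 7 6 []]),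
    ([1,2,3,0,4,0,0,5,0,2,6,3,0,4,0,0,0,0], Play 6 4 [Play 7 6 [], Play 3 6 []]),
    ([1,2,3,0,4,5,0,1,0,0,0,2,0,3,4,1,0,0,0,0], Play 9 5 [Play 11 6 []]),
    ([1,2,3,0,4,5,0,1,0,0,0,2,0,3,4,5,0,0,0,0], Play 9 5 [Play 11 6 []]),
    ([1,2,3,0,4,5,0,1,0,0,0,2,0,3,4,6,0,0,0,0], Play 9 5 [Play 11 6 []]),
    ([1,2,3,4,0,0,0,1,0,5,2,3,0,4,0,0,0,0], Play 6 5 [Play 5 6 []]),
    ([1,2,3,4,0,0,1,0,0,5,3,0,2,4,0,0,0,0], Play 8 5 [Play 5 6 []]),
    ([1,2,3,4,0,5,0,0,0,1,0,2,3,5,0,4,0,0,0,0], Play 7 5 [Play 9 6 []]),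
    ([1,2,3,4,0,5,0,0,0,1,0,2,3,5,0,6,0,0,0,0], Play 7 5 [Play 9 6 []]),
    ([1,2,3,0,0,0,4,1,3,0,2,0,0,0], Play 7 4 [Play 3 5 [Play 5 6 []]]),
    ([1,2,3,0,0,4,0,1,0,2,3,0,0,0], Play 3 4 [Recall 2 0 True]),
    ([1,2,3,0,0,4,0,1,0,2,5,0,0,0], Play 2 4 [Recall 2 0 True, Play 7 6 []]),
    ([1,2,3,0,0,4,0,1,2,0,3,0,0,0], Play 7 4 [Recall 3 0 False]),
    ([1,2,3,0,0,4,0,1,3,0,2,4,0,0,0,0], Play 3 4 [Recall 15 0 True]),
    ([1,2,3,0,0,4,0,1,5,0,2,4,0,0,0,0], Play 2 4 [Recall 15 0 True, Play 5 6 []]),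
    ([1,2,3,0,0,4,0,5,2,0,3,0,0,0], Play 8 4 [Recall 3 0 False, Play 3 6 []]),
    ([1,2,3,0,0,4,0,5,3,0,2,0,0,0], Play 8 4 [Recall 7 0 False, Play 3 6 []]),
    ([1,2,3,0,4,0,0,1,0,2,3,0,5,0,0,0], Play 2 4 [Recall 9 0 True, Recall 10 0 True]),
    ([1,2,3,0,4,0,0,1,0,2,3,4,0,0,0,0], Play 3 4 [Recall 14 0 True]),
    ([1,2,3,0,4,0,0,1,0,2,5,0,6,0,0,0], Play 3 4 [Recall 10 0 True, Play 7 6 []]),
    ([1,2,3,0,4,0,0,1,0,2,5,3,0,0,0,0], Play 2 4 [Play 7 5 [Play 9 6 []], Play 7 6 []]),
    ([1,2,3,0,4,0,0,1,0,2,5,4,0,0,0,0], Play 2 4 [Recall 14 0 True, Play 7 6 []]),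
    ([1,2,3,0,4,0,0,1,0,2,5,4,0,6,0,0,0,0], Play 2 4 [Recall 17 0 False, Play 7 6 []]),
    ([1,2,0,0,3,1,4,0,2,3,0,0,0,0], Play 2 3 [Recall 22 0 False, Recall 23 0 False]),
    ([1,2,0,3,0,1,0,2,4,0,0,0], Play 2 3 [Recall 21 0 True, Recall 24 0 True]),
    ([1,2,0,3,0,1,0,2,4,3,0,5,0,0,0,0], Play 2 3 [Play 3 4 [Recall 16 0 False, Recall 17 0
      False], Play 2 4 [Recall 16 0 False, Play 7 6 []], Recall 31 0 False]),
    ([1,2,0,3,0,1,0,4,5,0,0,0], Play 1 3 [Recall 24 0 True, Play 6 5 [Play 5 6 []], Play 5 6
      []]),
    ([1,2,0,3,0,1,0,4,5,2,0,0,0,0], Play 1 3 [Recall 29 0 False, Play 5 5 [Play 7 6 []], Play 5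
      6 []]),
    ([1,2,3,0,0,0,4,1,3,0,5,0,0,0], Play 3 4 [Recall 29 0 True, Play 6 4 [Play 9 6 [], Play 5 6
      []]]),
    ([1,2,3,0,0,1,0,4,0,2,3,0,0,0], Play 2 4 [Recall 22 0 True, Recall 23 0 True]),
    ([1,2,3,0,0,1,0,4,2,0,3,0,0,0], Play 1 3 [Recall 27 0 True, Recall 30 0 True]),
    ([1,2,0,3,0,1,0,2,3,0,0,0], Play 2 3 [Recall 39 0 True]),
    ([1,2,0,3,0,1,0,2,3,0,4,0,0,0], Play 8 4 [Recall 34 0 False]),
    ([1,2,0,3,0,1,0,4,3,0,0,0], Play 7 3 [Play 2 3 [Recall 27 0 False, Recall 30 0 False], Play
      1 3 [Play 5 5 [Play 7 6 []], Recall 30 0 False, Play 5 6 []]]),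
    ([1,2,0,3,0,1,0,4,3,0,5,0,0,0], Play 7 4 [Recall 34 0 False, Play 1 3 [Play 5 5 [Play 7 6
      []], Play 5 6 [], Recall 31 0 False]]),
    ([1,2,0,3,0,4,1,0,2,0,0,0], Play 0 2 [Recall 39 0 False, Recall 21 0 False, Recall 24 0
      False]),
    ([1,2,3,0,0,0,2,3,1,4,0,0,0,0], Play 4 2 [Play 7 3 [Play 5 4 [Play 7 5 [Play 11 6 []]], Play
      5 4 [Play 10 5 [Play 7 6 []], Play 7 5 [Play 11 6 []]]], Play 7 3 [Play 7 4 [Play 6 5
      [Play 3 6 []]], Play 3 5 [Play 9 6 []]], Play 7 3 [Play 3 4 [Play 7 5 [Play 9 6 []], Play
      7 5 [Play 9 6 []]], Play 3 5 [Play 9 6 []], Play 3 5 [Play 9 6 []]]]),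
    ([1,2,3,0,0,0,2,3,4,1,0,0,0,0], Play 5 2 [Play 4 3 [Play 5 4 [Recall 11 0 False], Play 4 4
      [Recall 11 0 False, Play 9 6 []]], Play 7 3 [Play 7 4 [Recall 4 0 False], Play 8 4 [Recall
      4 0 False, Play 3 6 []]], Play 7 3 [Play 3 5 [Play 5 5 [Play 11 6 []], Play 9 6 []], Play
      8 5 [Play 3 5 [Play 5 6 []], Play 3 6 []], Play 4 4 [Play 9 6 [], Play 3 6 []]]]),
    ([1,2,3,0,0,0,2,3,4,5,0,0,0,0], Play 5 2 [Play 4 3 [Play 5 4 [Recall 12 0 False, Recall 13 0
      False], Play 4 4 [Recall 12 0 False, Play 9 6 []], Play 4 4 [Recall 13 0 False, Play 9 6
      []]], Play 7 3 [Play 7 4 [Recall 5 0 False, Recall 6 0 False], Play 8 4 [Recall 5 0 False,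
      Play 3 6 []], Play 8 4 [Recall 6 0 False, Play 3 6 []]], Play 4 3 [Play 3 5 [Play 10 5
      [Play 9 6 []], Play 9 6 []], Play 8 5 [Play 8 5 [Play 3 6 []], Play 3 6 []], Play 8 4
      [Play 9 6 [], Play 3 6 []]], Play 4 3 [Play 4 4 [Play 9 5 [Play 11 6 []], Play 9 6 []],
      Play 8 5 [Play 3 5 [Play 9 6 []], Play 3 6 []], Play 8 4 [Play 9 6 [], Play 3 6 []]]]),
    ([1,0,2,3,0,0,1,4,3,0,0,0], Play 8 3 [Play 4 4 [Play 1 3 [Play 5 5 [Play 9 6 []], Play 2 4
      [Play 7 5 [Play 11 6 []], Play 7 6 []], Play 5 6 []]], Play 1 3 [Play 2 4 [Play 7 5 [Play
      9 6 []], Play 7 6 []], Play 5 5 [Play 7 6 []], Play 5 6 []]]),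
    ([1,2,0,0,1,2,3,0,0,0], Play 3 2 [Recall 40 0 False, Recall 33 0 False]),
    ([1,2,0,0,3,1,2,0,0,0], Play 3 3 [Recall 44 0 False]),
    ([1,2,0,1,0,3,0,2,0,0], Play 1 2 [Recall 40 0 True, Recall 42 0 True]),
    ([1,0,2,0,1,3,0,0], Play 3 3 [Play 1 2 [Play 0 2 [Recall 38 0 False, Recall 19 0 False,
      Recall 20 0 True], Play 2 3 [Play 3 4 [Recall 7 0 True], Recall 25 0 True], Play 1 3 [Play
      6 5 [Play 3 6 []], Recall 25 0 True, Play 5 6 []]]]),
    ([1,0,2,3,0,0,1,4,0,0], Play 8 2 [Play 4 4 [Play 1 3 [Play 5 5 [Play 9 6 []], Play 2 4 [Play
      7 5 [Play 11 6 []], Play 7 6 []], Play 5 6 []]], Recall 48 0 False, Play 1 3 [Play 2 4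
      [Play 7 5 [Play 9 6 []], Play 7 6 []], Play 5 5 [Play 7 6 []], Play 5 6 []]]),
    ([1,2,0,0,1,0,2,3,0,0], Play 5 3 [Play 2 3 [Recall 38 0 False, Play 4 3 [Play 5 4 [Recall 8
      0 True], Play 4 4 [Recall 8 0 True, Play 9 6 []]], Play 1 3 [Play 8 5 [Play 5 6 []], Play
      6 4 [Play 12 4 [Play 10 5 [Play 5 6 []], Play 7 6 []], Play 9 6 []], Play 8 4 [Play 5 6
      [], Play 9 6 []]]]]),
    ([1,2,0,0,1,2,0,0], Play 2 2 [Recall 50 0 True]),
    ([1,2,0,0,1,3,0,0,2,4,0,0], Play 3 2 [Recall 51 0 True, Play 8 4 [Play 4 4 [Play 10 5 [Play
      5 6 []], Play 5 6 []]], Play 1 3 [Recall 44 0 True, Play 10 4 [Play 5 5 [Play 11 6 []],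
      Play 5 6 []], Play 5 5 [Play 12 4 [Play 12 5 [Play 7 6 []], Play 7 6 []]]]]),
    ([1,2,0,0,1,3,0,0,4,2,0,0], Play 3 2 [Recall 51 0 True, Play 4 4 [Play 10 4 [Play 5 5 [Play
      11 6 []], Play 5 6 []]], Play 1 3 [Recall 44 0 True, Play 10 4 [Play 5 5 [Play 11 6 []],
      Play 5 6 []], Play 10 4 [Play 6 4 [Play 5 6 [], Play 11 6 []], Play 5 5 [Play 7 6 []]]]]),
    ([1,0,2,0,1,2,0,0], Play 2 1 [Recall 55 2 False, Play 7 2 [Recall 50 2 False, Recall 48 0
      False]]),
    ([1,0,2,0,3,2,0,0], Play 3 2 [Play 2 1 [Recall 51 2 False, Play 7 3 [Recall 44 2 False],
      Play 8 3 [Recall 44 2 False, Play 1 3 [Play 2 4 [Play 8 5 [Play 7 6 []], Play 7 6 []],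
      Play 5 5 [Play 7 6 []], Play 5 6 []]]], Play 1 2 [Play 1 3 [Recall 41 0 True, Play 9 3
      [Play 9 4 [Recall 9 0 False, Play 5 6 []], Recall 26 0 True, Recall 28 0 True]], Play 2 3
      [Recall 41 0 True, Recall 43 0 True], Play 1 3 [Play 10 3 [Play 6 5 [Play 3 6 []], Recall
      26 0 True, Play 6 4 [Play 7 6 [], Play 3 6 []]], Recall 43 0 True, Play 10 3 [Play 5 6 [],
      Recall 28 0 True, Play 6 5 [Play 5 6 []]]]]]),
    ([1,0,2,3,0,0,4,1,0,0], Play 0 1 [Recall 57 0 False, Play 0 2 [Recall 50 0 True, Play 8 4
      [Play 4 3 [Play 6 4 [Play 7 5 [Play 13 6 []], Play 7 6 []], Play 6 4 [Play 7 5 [Play 13 6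
      []], Play 3 6 []], Play 6 4 [Play 7 6 [], Play 3 6 []]]], Play 8 4 [Play 4 3 [Play 3 5
      [Play 7 6 []], Play 5 5 [Play 7 5 [Play 13 6 []], Play 11 6 []], Play 3 5 [Play 7 6 []]],
      Play 4 4 [Play 6 4 [Play 11 6 [], Play 3 6 []], Play 9 6 [], Play 6 4 [Play 3 6 [], Play
      11 6 []]]]], Play 2 4 [Play 8 4 [Play 3 5 [Play 9 6 []], Play 3 6 []]], Play 6 4 [Play 2 4
      [Play 3 5 [Play 9 6 []], Play 7 6 []], Play 0 2 [Play 1 3 [Play 6 4 [Play 7 6 [], Play 8 4
      [Play 5 6 [], Play 13 6 []]], Play 5 6 [], Play 5 5 [Play 7 6 []]], Play 4 4 [Play 5 6 [],
      Play 6 4 [Play 3 6 [], Play 11 6 []]], Play 3 6 [], Play 3 5 [Play 5 6 []]]]]),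
    ([1,2,0,0,1,0,1,2,0,0], Play 5 1 [Recall 55 0 False, Play 3 2 [Recall 51 0 True, Play 1 3
      [Recall 44 0 True, Play 10 4 [Play 10 5 [Play 5 5 [Play 7 6 []], Play 5 6 []], Play 5 5
      [Play 7 6 []], Play 5 6 []]]]]),
    ([1,2,0,0,1,3,0,0,4,5,0,0], Play 3 2 [Recall 51 0 True, Play 1 3 [Recall 44 0 True, Play 10
      4 [Play 10 5 [Play 5 6 []], Play 5 6 []], Play 10 4 [Play 6 4 [Play 5 6 [], Play 11 6 []],
      Play 6 5 [Play 5 6 []]]], Play 1 3 [Recall 44 0 True, Play 10 4 [Play 10 5 [Play 5 6 []],
      Play 5 6 []], Play 10 4 [Play 6 4 [Play 5 6 [], Play 11 6 []], Play 6 5 [Play 5 6 []]]],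
      Play 12 2 [Play 7 2 [Recall 33 0 False, Recall 35 0 False, Recall 35 0 False, Play 9 5
      [Play 11 6 []]], Play 7 2 [Recall 33 0 False, Recall 35 0 False, Recall 35 0 False, Play 9
      6 []], Play 8 2 [Play 8 3 [Recall 36 0 False, Recall 36 0 False, Play 11 5 [Play 13 6
      []]], Recall 35 0 False, Recall 35 0 False, Recall 42 0 False], Play 8 2 [Play 9 6 [],
      Recall 35 0 False, Recall 35 0 False, Recall 42 0 False]]]),
    ([1,0,1,2,0,0,3,4,0,0], Play 1 1 [Recall 55 0 False, Recall 56 0 False, Recall 57 0 False,
      Recall 62 0 False]),
    ([1,0,2,0,1,0], Play 0 1 [Recall 58 0 True, Recall 52 0 True]),
    ([1,2,0,0,1,3,0,0,1,4,0,0], Play 9 2 [Play 5 2 [Recall 49 0 False, Play 4 2 [Recall 18 4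
      True, Play 8 3 [Recall 32 0 False, Recall 1 4 True], Recall 37 4 True], Play 5 3 [Play 0 2
      [Recall 46 0 False, Recall 47 0 False, Recall 45 0 False, Recall 47 0 False], Recall 0 4
      True, Play 9 6 []]], Recall 49 4 False, Play 3 2 [Recall 51 0 True, Play 8 2 [Play 7 3
      [Play 11 5 [Play 13 6 []], Recall 36 0 False, Play 11 6 []], Recall 42 0 False, Recall 35
      0 False, Recall 35 0 False], Play 8 2 [Play 6 4 [Play 11 5 [Play 13 6 []], Play 11 6 []],
      Recall 35 0 False, Recall 42 0 False, Recall 35 0 False], Play 8 2 [Play 7 3 [Recall 36 0
      False, Recall 36 0 False, Play 11 6 []], Recall 35 0 False, Recall 35 0 False, Recall 42 0
      False]]]),
    ([1,2,0,0,1,0,1,3,0,0], Play 5 1 [Recall 55 0 False, Recall 55 4 False, Recall 65 0 False]),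
    ([1,0,1,2,0,0], Play 2 0 [Play 1 1 [Recall 61 0 False, Recall 66 0 False], Recall 58 0
      False, Recall 52 0 False]),
    ([1,0,2,1,0,0], Play 0 0 [Play 0 1 [Recall 61 0 True, Recall 66 0 True], Recall 58 0 False,
      Recall 59 0 False]),
    ([1,0,1,0], Play 0 1 [Recall 67 0 True]),
    ([1,2,0,0,2,3,0,0], Play 4 0 [Recall 54 0 False, Recall 67 0 True, Recall 54 0 True, Play 2
      3 [Play 7 3 [Recall 19 0 False, Recall 20 0 True], Play 7 3 [Recall 20 0 False, Play 4 3
      [Play 4 4 [Play 10 5 [Play 9 6 []], Play 9 6 []], Play 8 5 [Play 3 5 [Play 9 6 []], Play 3
      6 []], Play 8 4 [Play 9 6 [], Play 3 6 []]], Play 4 4 [Play 7 6 [], Play 3 6 []]]]]),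
    ([], Play 0 0 [Play 0 0 [Recall 69 0 False, Play 1 1 [Recall 67 0 True, Play 4 0 [Recall 69
      4 False, Recall 59 0 True, Recall 67 0 True, Play 4 1 [Recall 68 4 True, Play 8 1 [Recall
      65 0 False, Recall 56 0 False, Recall 70 4 False, Recall 62 0 False], Recall 70 0 False,
      Play 8 0 [Recall 69 8 False, Recall 60 0 True, Recall 53 0 True, Recall 63 0 True, Recall
      59 4 True, Play 8 0 [Recall 64 8 False, Recall 60 0 True, Recall 53 0 True, Recall 63 0
      True, Recall 59 4 True, Recall 69 8 False]]]]]]])]"

text \<open>A finite computation: in each row every relevant answer is followed until a seventh
  colour is unavoidable or an earlier row recurs.\<close>

lemma certified_strategies: "certified [] strategies"
  by code_simp

lemma forced_Nil: "forced ([] :: nat endpoint list)"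
proof -
  have "[] \<in> fst ` set strategies"
    by (simp add: strategies_def)
  then show ?thesis
    using certified_forced[OF certified_strategies] by fastforce
qed

section \<open>Intersection graphs of proper families\<close>

text \<open>Density of the reals provides the separating point; unboundedness covers the cases in
  which one of the sets is empty. It is used both to place unit intervals and to realize the moves
  of the adversary.\<close>

lemma finite_separation:
  fixes A B :: "real set"
  assumes "finite A" "finite B" "\<And>a b. a \<in> A \<Longrightarrow> b \<in> B \<Longrightarrow> a < b"
  shows "\<exists>x. (\<forall>a\<in>A. a < x) \<and> (\<forall>b\<in>B. x < b)"
proof -
  have "\<exists>x. (\<forall>a\<in>A. a < x) \<and> x < m" if "\<forall>a\<in>A. a < m" for m
  proof (cases "A = {}")
    case True
    then show ?thesis by (simp add: lt_ex)
  next
    case False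
    then have "Max A < m" using that assms(1) by simp
    then obtain x where "Max A < x" "x < m" using dense by blast
    then show ?thesis using assms(1) False by auto
  qed
  moreover have "\<exists>m. (\<forall>a\<in>A. a < m) \<and> (\<forall>b\<in>B. m \<le> b)"
  proof (cases "B = {}")
    case True
    obtain c where "\<forall>a\<in>A. a \<le> c"
      using bdd_above_finite[OF assms(1)] unfolding bdd_above_def by blast
    then have "\<forall>a\<in>A. a < c + 1" by fastforce
    then show ?thesis using True by blast
  next
    case False
    then have "\<forall>a\<in>A. a < Min B" "\<forall>b\<in>B. Min B \<le> b"
      using assms by simp_all
    then show ?thesis by blast
  qed
  ultimately show ?thesis by (meson less_le_trans)
qed

text \<open>
  Roberts' theorem, by a greedy construction: scanning the intervals from left to right, the position
  of the next unit interval can be chosen right of all earlier ones, within distance 1 of exactly the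
  earlier intervals that it meets. Positions at distance exactly 1 are avoided throughout.
\<close>

lemma unit_positions_exist:
  fixes l r :: "'v \<Rightarrow> real"
  assumes "finite V" "\<And>u v. u \<in> V \<Longrightarrow> v \<in> V \<Longrightarrow> u \<noteq> v \<Longrightarrow> l u < l v \<and> r u < r v \<or> l v < l u \<and> r v < r u"
  shows "\<exists>x :: 'v \<Rightarrow> real. \<forall>u\<in>V. \<forall>v\<in>V. l u < l v \<longrightarrow> x u < x v \<and> x v \<noteq> x u + 1 \<and> (l v \<le> r u \<longleftrightarrow> x v < x u + 1)"
  using assms
proof (induction V rule: finite_ranking_induct[where f = l])
  case empty
  then show ?case by simp
next
  case (insert w V)
  show ?case
  proof (cases "w \<in> V")
    case True
    then show ?thesis using insert by (simp add: insert_absorb)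
  next
    case False
    obtain x :: "'v \<Rightarrow> real" where x: "\<And>u v. u \<in> V \<Longrightarrow> v \<in> V \<Longrightarrow> l u < l v \<Longrightarrow>
        x u < x v \<and> x v \<noteq> x u + 1 \<and> (l v \<le> r u \<longleftrightarrow> x v < x u + 1)"
      using insert.IH insert.prems by (metis insertI2)
    \<comment> \<open>Intervals are inserted by increasing left end, so by properness the new one
      also has the largest right end.\<close>
    have w: "l u < l w \<and> r u < r w" if "u \<in> V" for u
      using insert.prems[of u w] insert.hyps(2)[OF that] False that by (metis insertCI linorder_not_less)
    have mono: "r u < r v \<longleftrightarrow> l u < l v" if "u \<in> V" "v \<in> V" for u v
      using insert.prems[of u v] that by fastforce
    \<comment> \<open>The new position must exceed \<open>?A\<close>, the old positions and the
      right ends of the unit intervals to be missed, and stay below \<open>?B\<close>, the right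
      ends of those to be met.\<close>
    let ?A = "x ` V \<union> (\<lambda>u. x u + 1) ` {u \<in> V. r u < l w}"
    let ?B = "(\<lambda>u. x u + 1) ` {u \<in> V. l w \<le> r u}"
    have separated: "a < b" if a: "a \<in> ?A" and b: "b \<in> ?B" for a b
    proof -
      obtain v where v: "v \<in> V" "l w \<le> r v" "b = x v + 1" using b by blast
      from a show ?thesis
      proof
        assume "a \<in> x ` V"
        then obtain u where u: "u \<in> V" "a = x u" by blast
        consider "u = v" | "l u < l v" | "l v < l u"
          using insert.prems[of u v] u v by auto
        then show ?thesis
        proof cases
          \<comment> \<open>Here \<open>l u < l w \<le> r v\<close>, so \<open>u\<close> meets
            \<open>v\<close>, which gives \<open>x u < x v + 1\<close>.\<close>
          case 3
          then show ?thesis using x[of v u] u v w[of u] by fastforce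
        qed (use x[of u v] u v in auto)
      next
        assume "a \<in> (\<lambda>u. x u + 1) ` {u \<in> V. r u < l w}"
        then obtain u where u: "u \<in> V" "r u < l w" "a = x u + 1" by blast
        then have "l u < l v" using mono[of u v] v by linarith
        then show ?thesis using x[of u v] u v by simp
      qed
    qed
    have "finite ?A" "finite ?B"
      using insert.hyps(1) by simp_all
    from finite_separation[OF this separated]
    obtain y where "(\<forall>a\<in>?A. a < y) \<and> (\<forall>b\<in>?B. y < b)" ..
    note y = this[THEN conjunct1, rule_format] this[THEN conjunct2, rule_format]
    have new: "x u < y \<and> y \<noteq> x u + 1 \<and> (l w \<le> r u \<longleftrightarrow> y < x u + 1)" if "u \<in> V" for u
    proof (cases "l w \<le> r u")
      case True
      then show ?thesis using y(1)[of "x u"] y(2)[of "x u + 1"] that by auto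
    next
      case False
      then show ?thesis using y(1)[of "x u"] y(1)[of "x u + 1"] that by fastforce
    qed
    let ?x = "x(w := y)"
    have "?x u < ?x v \<and> ?x v \<noteq> ?x u + 1 \<and> (l v \<le> r u \<longleftrightarrow> ?x v < ?x u + 1)"
      if "u \<in> insert w V" "v \<in> insert w V" "l u < l v" for u v
    proof (cases "v = w")
      case True
      then show ?thesis using that new[of u] by auto
    next
      case False
      then have "u \<noteq> w" using that w[of v] by fastforce
      then show ?thesis using that False x[of u v] by simp
    qed
    then show ?thesis by blast
  qed
qed

section \<open>From proper families to presented unit interval graphs\<close>

definition intersection_graph :: "(real \<times> real) list \<Rightarrow> nat pair_pre_digraph" where
  "intersection_graph ps = \<lparr>pverts = {..<length ps},
     parcs = {(u, v). u < length ps \<and> v < length ps \<and> u \<noteq> v \<and>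
       fst (ps ! u) \<le> snd (ps ! v) \<and> fst (ps ! v) \<le> snd (ps ! u)}\<rparr>"

definition interval :: "real \<times> real \<Rightarrow> real set" where
  "interval p = {fst p..snd p}"

text \<open>Stricter than properness of a representation: left ends are pairwise distinct, and so
  are right ends. The strictly sorted words of the game provide this.\<close>

definition proper_list :: "(real \<times> real) list \<Rightarrow> bool" where
  "proper_list ps \<longleftrightarrow> (\<forall>v<length ps. fst (ps ! v) \<le> snd (ps ! v)) \<and>
     (\<forall>u<length ps. \<forall>v<length ps. u \<noteq> v \<longrightarrow>
        fst (ps ! u) < fst (ps ! v) \<and> snd (ps ! u) < snd (ps ! v) \<or>
        fst (ps ! v) < fst (ps ! u) \<and> snd (ps ! v) < snd (ps ! u))"

lemma pair_graph_intersection_graph: "pair_graph (intersection_graph ps)"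
proof
  show "finite (pverts (intersection_graph ps))"
    by (simp add: intersection_graph_def)
  show "finite (parcs (intersection_graph ps))"
    by (rule finite_subset[of _ "{..<length ps} \<times> {..<length ps}"]) (auto simp: intersection_graph_def)
  show "symmetric (with_proj (intersection_graph ps))"
    by (auto simp: symmetric_def intersection_graph_def arcs_ends_def arc_to_ends_def sym_def)
qed (auto simp: intersection_graph_def)

text \<open>Needed because algorithms are constrained only on unit interval graphs. The unit
  representation only certifies membership in this class; the algorithm is shown the original
  intervals.\<close>

lemma unit_interval_graph_intersection_graph:
  assumes "proper_list ps"
  shows "unit_interval_graph (intersection_graph ps)"
proof -
  define l r where "l v = fst (ps ! v)" and "r v = snd (ps ! v)" for v
  let ?V = "{..<length ps}"
  have lr: "l v \<le> r v" if "v \<in> ?V" for v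
    using assms that by (auto simp: proper_list_def l_def r_def)
  have mono: "l u < l v \<and> r u < r v \<or> l v < l u \<and> r v < r u" if "u \<in> ?V" "v \<in> ?V" "u \<noteq> v" for u v
    using assms that by (auto simp: proper_list_def l_def r_def)
  obtain x :: "nat \<Rightarrow> real" where x: "\<And>u v. u \<in> ?V \<Longrightarrow> v \<in> ?V \<Longrightarrow> l u < l v \<Longrightarrow>
      x u < x v \<and> x v \<noteq> x u + 1 \<and> (l v \<le> r u \<longleftrightarrow> x v < x u + 1)"
    using unit_positions_exist[of ?V l r] mono by blast
  have "(l u \<le> r v \<and> l v \<le> r u) \<longleftrightarrow> {x u..x u + 1} \<inter> {x v..x v + 1} \<noteq> {}"
    if "u \<in> ?V" "v \<in> ?V" "u \<noteq> v" for u v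
  proof -
    have *: "(l u \<le> r v \<and> l v \<le> r u) \<longleftrightarrow> {x u..x u + 1} \<inter> {x v..x v + 1} \<noteq> {}"
      if "u \<in> ?V" "v \<in> ?V" "l u < l v" for u v
    proof -
      have "l u \<le> r v" using that lr[of v] by linarith
      moreover have "{x u..x u + 1} \<inter> {x v..x v + 1} \<noteq> {} \<longleftrightarrow> x v \<le> x u + 1"
        using x[OF that] by auto
      \<comment> \<open>Since distance exactly 1 is excluded, \<open>x v < x u + 1\<close> and
        \<open>x v \<le> x u + 1\<close> are equivalent.\<close>
      ultimately show ?thesis
        using x[OF that] by linarith
    qed
    show ?thesis
      using mono[OF that] *[of u v] *[of v u] that by (metis inf_commute)
  qed
  then have "unit_interval_representation (intersection_graph ps) (\<lambda>v. {x v..x v + 1})"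
    by (auto simp: unit_interval_representation_def interval_representation_def closed_interval_def
        intersection_graph_def l_def r_def)
  then show ?thesis
    using pair_graph_intersection_graph by (auto simp: unit_interval_graph_def)
qed

lemma interval_Int_iff:
  assumes "fst p \<le> snd p" "fst q \<le> snd q"
  shows "interval p \<inter> interval q \<noteq> {} \<longleftrightarrow> fst p \<le> snd q \<and> fst q \<le> snd p"
  using assms by (auto simp: interval_def Int_atLeastAtMost)

lemma presentation_intersection_graph:
  assumes "proper_list ps"
  shows "presentation (intersection_graph ps) (\<lambda>v. interval (ps ! v)) [0..<length ps]"
proof -
  have le: "fst (ps ! v) \<le> snd (ps ! v)" if "v < length ps" for v
    using assms that unfolding proper_list_def by blast
  have proper: "\<not> interval (ps ! u) \<subset> interval (ps ! v)" if uv: "u < length ps" "v < length ps" for u v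
  proof
    assume sub: "interval (ps ! u) \<subset> interval (ps ! v)"
    then have "u \<noteq> v" by blast
    moreover have "fst (ps ! v) \<le> fst (ps ! u)" "snd (ps ! u) \<le> snd (ps ! v)"
      using sub le[OF uv(1)] by (simp_all add: interval_def psubset_eq)
    ultimately show False
      using assms uv unfolding proper_list_def by (meson linorder_not_less)
  qed
  have "interval_representation (intersection_graph ps) (\<lambda>v. interval (ps ! v))"
    unfolding interval_representation_def
  proof (intro conjI ballI impI)
    fix v assume "v \<in> pverts (intersection_graph ps)"
    then show "closed_interval (interval (ps ! v))"
      using le[of v] unfolding closed_interval_def interval_def intersection_graph_def by auto
  next
    fix u v assume "u \<in> pverts (intersection_graph ps)" "v \<in> pverts (intersection_graph ps)" "u \<noteq> v"
    then show "((u, v) \<in> parcs (intersection_graph ps)) \<longleftrightarrow> interval (ps ! u) \<inter> interval (ps ! v) \<noteq> {}"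
      using interval_Int_iff[OF le le, of u v] by (simp add: intersection_graph_def)
  qed
  then show ?thesis
    using proper by (simp add: presentation_def proper_interval_representation_def intersection_graph_def
        lessThan_atLeast0)
qed

section \<open>Playing against an algorithm\<close>

text \<open>The endpoints in \<open>W\<close> are labelled by the indices of the intervals \<open>ps\<close> presented so far.\<close>

definition position :: "(real \<times> real) list \<Rightarrow> (real \<times> nat endpoint) list \<Rightarrow> bool" where
  "position ps W \<longleftrightarrow> sorted_wrt (<) (map fst W) \<and>
     set W = (\<Union>v<length ps. {(fst (ps ! v), Left v), (snd (ps ! v), Right v)}) \<and>
     (\<forall>v<length ps. fst (ps ! v) \<le> snd (ps ! v)) \<and>
     lefts (map snd W) = rights (map snd W) \<and>
     (\<forall>u. prefix u (map snd W) \<longrightarrow> length (lefts u) \<le> length (rights u) + 4)"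

section \<open>Order and chromatic number of a position\<close>

text \<open>The sorted word lists the intervals once by left end and once by right end; in a
  \<open>position\<close> the two lists agree.\<close>

lemma position_sorted:
  assumes "position ps W"
  shows "sorted_wrt (\<lambda>u v. fst (ps ! u) < fst (ps ! v) \<and> snd (ps ! u) < snd (ps ! v)) (lefts (map snd W))"
proof -
  have sorted: "sorted_wrt (\<lambda>e f. fst e < fst f) W"
    using assms by (simp add: position_def sorted_wrt_map)
  have left: "fst e = fst (ps ! colour (snd e))" if "e \<in> set W" "is_left (snd e)" for e
    using assms that by (auto simp: position_def)
  have right: "fst e = snd (ps ! colour (snd e))" if "e \<in> set W" "\<not> is_left (snd e)" for e
    using assms that by (auto simp: position_def)
  have "sorted_wrt (\<lambda>e f. fst (ps ! colour (snd e)) < fst (ps ! colour (snd f))) (filter (is_left \<circ> snd) W)"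
    by (rule sorted_wrt_mono_rel[OF _ sorted_wrt_filter[OF sorted]]) (simp add: left)
  then have "sorted_wrt (\<lambda>u v. fst (ps ! u) < fst (ps ! v)) (lefts (map snd W))"
    by (simp add: lefts_def filter_map sorted_wrt_map)
  moreover
  have "sorted_wrt (\<lambda>e f. snd (ps ! colour (snd e)) < snd (ps ! colour (snd f)))
      (filter ((\<lambda>e. \<not> is_left e) \<circ> snd) W)"
    by (rule sorted_wrt_mono_rel[OF _ sorted_wrt_filter[OF sorted]]) (simp add: right)
  then have "sorted_wrt (\<lambda>u v. snd (ps ! u) < snd (ps ! v)) (rights (map snd W))"
    by (simp add: rights_def filter_map sorted_wrt_map)
  then have "sorted_wrt (\<lambda>u v. snd (ps ! u) < snd (ps ! v)) (lefts (map snd W))"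
    using assms by (simp add: position_def)
  ultimately show ?thesis
    by (simp add: sorted_wrt_iff_nth_less)
qed

lemma position_set_lefts:
  assumes "position ps W"
  shows "set (lefts (map snd W)) = {..<length ps}"
proof -
  have "set (lefts (map snd W)) = {v. \<exists>x. (x, Left v) \<in> set W}"
    by (force simp: lefts_def)
  also have "\<dots> = {..<length ps}"
    using assms by (auto simp: position_def)
  finally show ?thesis .
qed

lemma position_proper_list:
  assumes "position ps W"
  shows "proper_list ps"
  unfolding proper_list_def
proof (intro conjI allI impI)
  fix u v assume uv: "u < length ps" "v < length ps" "u \<noteq> v"
  then obtain i j where ij: "i < length (lefts (map snd W))" "j < length (lefts (map snd W))"
      "lefts (map snd W) ! i = u" "lefts (map snd W) ! j = v"
    using position_set_lefts[OF assms] by (metis in_set_conv_nth lessThan_iff)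
  then have "i < j \<or> j < i"
    using uv(3) by (metis linorder_neqE_nat)
  then show "fst (ps ! u) < fst (ps ! v) \<and> snd (ps ! u) < snd (ps ! v) \<or>
      fst (ps ! v) < fst (ps ! u) \<and> snd (ps ! v) < snd (ps ! u)"
    using sorted_wrt_nth_less[OF position_sorted[OF assms]] ij by blast
qed (use assms in \<open>simp add: position_def\<close>)

text \<open>If the intervals numbered \<open>i < j\<close> meet, then those numbered
  \<open>i\<close> to \<open>j\<close> are all open when the last of them opens, so
  \<open>j < i + 4\<close> and the residues modulo 4 differ.\<close>

lemma position_chromatic_number:
  assumes "position ps W"
  shows "chromatic_number (intersection_graph ps) \<le> 4"
proof -
  define vs where "vs = lefts (map snd W)"
  have sorted: "fst (ps ! (vs ! i)) < fst (ps ! (vs ! j)) \<and> snd (ps ! (vs ! i)) < snd (ps ! (vs ! j))"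
    if "i < j" "j < length vs" for i j
    using sorted_wrt_nth_less[OF position_sorted[OF assms]] that by (simp add: vs_def)
  have set_vs: "set vs = {..<length ps}"
    using position_set_lefts[OF assms] by (simp add: vs_def)
  have distinct: "distinct vs"
    unfolding distinct_conv_nth by (metis sorted less_irrefl linorder_neqE_nat)
  have close: "j < i + 4"
    if ij: "i < j" "j < length vs" and meet: "fst (ps ! (vs ! j)) \<le> snd (ps ! (vs ! i))" for i j
  proof -
    define u v where "u = vs ! i" and "v = vs ! j"
    have "v < length ps" "u < length ps"
      using set_vs ij nth_mem[of j vs] nth_mem[of i vs] by (auto simp: u_def v_def)
    then have "(fst (ps ! v), Left v) \<in> set W"
      using assms by (auto simp: position_def)
    then obtain W1 W2 where W: "W = W1 @ (fst (ps ! v), Left v) # W2"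
      by (meson split_list)
    have "vs = lefts (map snd W1) @ v # lefts (map snd W2)"
      by (simp add: vs_def W)
    moreover from this have "vs ! length (lefts (map snd W1)) = v" "length (lefts (map snd W1)) < length vs"
      by (metis nth_append_length, simp)
    then have "length (lefts (map snd W1)) = j"
      using distinct ij(2) by (simp add: v_def nth_eq_iff_index_eq)
    moreover have "prefix (map snd W1 @ [Left v]) (map snd W)"
      by (simp add: W)
    \<comment> \<open>The prefix ends with \<open>Left v\<close> itself, so it contains
      \<open>j + 1\<close> left endpoints.\<close>
    ultimately have "Suc j \<le> length (rights (map snd W1)) + 4"
      using assms unfolding position_def by fastforce
    \<comment> \<open>Intervals close in the order \<open>vs\<close>. With more than
      \<open>i\<close> right endpoints in \<open>W1\<close>, interval \<open>u\<close> would have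
      closed before \<open>v\<close> opens.\<close>
    moreover have "length (rights (map snd W1)) \<le> i"
    proof (rule ccontr)
      assume "\<not> ?thesis"
      moreover have "vs = rights (map snd W)"
        using assms by (simp add: position_def vs_def)
      ultimately have "rights (map snd W1) ! i = u" "i < length (rights (map snd W1))"
        by (simp_all add: W u_def nth_append)
      then have "u \<in> set (rights (map snd W1))" by (metis nth_mem)
      then obtain x where x: "(x, Right u) \<in> set W1"
        by (force simp: rights_def elim: endpoint.exhaust)
      then have "x = snd (ps ! u)"
        using assms W by (auto simp: position_def)
      moreover have "x < fst (ps ! v)"
        using assms x by (force simp: position_def W sorted_wrt_append)
      ultimately show False
        using meet by (simp add: u_def v_def)
    qed
    ultimately show ?thesis by linarith
  qed
  have "\<forall>v\<in>{..<length ps}. \<exists>i. i < length vs \<and> vs ! i = v"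
    using set_vs by (metis in_set_conv_nth)
  then obtain k where k: "\<And>v. v < length ps \<Longrightarrow> k v < length vs \<and> vs ! k v = v"
    by (metis bchoice lessThan_iff)
  have "k u mod 4 \<noteq> k v mod 4" if "(u, v) \<in> parcs (intersection_graph ps)" for u v
  proof -
    have uv: "u < length ps" "v < length ps" "u \<noteq> v"
      "fst (ps ! u) \<le> snd (ps ! v)" "fst (ps ! v) \<le> snd (ps ! u)"
      using that by (auto simp: intersection_graph_def)
    then have "k u \<noteq> k v" using k[of u] k[of v] by auto
    moreover have "k v < k u + 4" if "k u < k v"
      using close[OF that] k[of u] k[of v] uv by simp
    moreover have "k u < k v + 4" if "k v < k u"
      using close[OF that] k[of u] k[of v] uv by simp
    moreover have "a mod 4 \<noteq> b mod 4" if "a < b" "b < a + 4" for a b :: nat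
      using that by presburger
    ultimately show ?thesis
      by (metis linorder_neqE_nat)
  qed
  then have "(\<lambda>v. k v mod 4) ` pverts (intersection_graph ps) \<subseteq> {..<4} \<and>
      (\<forall>(u, v)\<in>parcs (intersection_graph ps). k u mod 4 \<noteq> k v mod 4)"
    by auto
  then show ?thesis
    unfolding chromatic_number_def by (intro Least_le exI)
qed

section \<open>Realizing the moves against an algorithm\<close>

lemma position_insert:
  assumes pos: "position ps (W1 @ W2 @ W3)" and fits: "fits (map snd W1) (map snd W2) (map snd W3)"
  obtains x y where "position (ps @ [(x, y)]) (W1 @ (x, Left (length ps)) # W2 @ (y, Right (length ps)) # W3)"
proof -
  have sorted: "sorted_wrt (<) (map fst W1 @ map fst W2 @ map fst W3)"
    using pos by (simp add: position_def)
  have lt: "a < b" if "a \<in> fst ` set W1 \<and> b \<in> fst ` (set W2 \<union> set W3) \<or> a \<in> fst ` set W2 \<and> b \<in> fst ` set W3" for a b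
    using sorted that unfolding sorted_wrt_append set_append set_map image_Un by blast
  have "\<exists>x. (\<forall>a\<in>fst ` set W1. a < x) \<and> (\<forall>b\<in>fst ` (set W2 \<union> set W3). x < b)"
    by (rule finite_separation) (simp_all add: lt)
  then obtain x where "(\<forall>a\<in>fst ` set W1. a < x) \<and> (\<forall>b\<in>fst ` (set W2 \<union> set W3). x < b)" ..
  note x = this[THEN conjunct1, rule_format] this[THEN conjunct2, rule_format]
  have separated: "a < b" if "a \<in> insert x (fst ` (set W1 \<union> set W2))" "b \<in> fst ` set W3" for a b
    using that lt[of a b] x(2)[of b] by (auto simp: image_Un)
  \<comment> \<open>Including \<open>x\<close> in the left-hand set ensures \<open>x < y\<close>
    even if \<open>W2\<close> is empty.\<close>
  have "\<exists>y. (\<forall>a\<in>insert x (fst ` (set W1 \<union> set W2)). a < y) \<and> (\<forall>b\<in>fst ` set W3. y < b)"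
    by (rule finite_separation[OF _ _ separated]) simp_all
  then obtain y where "(\<forall>a\<in>insert x (fst ` (set W1 \<union> set W2)). a < y) \<and> (\<forall>b\<in>fst ` set W3. y < b)" ..
  note y = this[THEN conjunct1, rule_format] this[THEN conjunct2, rule_format]
  let ?n = "length ps"
  let ?ps = "ps @ [(x, y)]"
  let ?W = "W1 @ (x, Left ?n) # W2 @ (y, Right ?n) # W3"
  let ?w1 = "map snd W1" and ?w2 = "map snd W2" and ?w3 = "map snd W3"
  have "sorted_wrt (<) (map fst ?W)"
    using sorted x y by (auto simp: sorted_wrt_append)
  moreover have "set ?W = (\<Union>v<length ?ps. {(fst (?ps ! v), Left v), (snd (?ps ! v), Right v)})"
  proof -
    have "(\<Union>v<length ?ps. {(fst (?ps ! v), Left v), (snd (?ps ! v), Right v)}) =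
        {(x, Left ?n), (y, Right ?n)} \<union> (\<Union>v<?n. {(fst (?ps ! v), Left v), (snd (?ps ! v), Right v)})"
      by (simp add: lessThan_Suc)
    also have "(\<Union>v<?n. {(fst (?ps ! v), Left v), (snd (?ps ! v), Right v)}) = set (W1 @ W2 @ W3)"
      using pos unfolding position_def by (simp add: nth_append)
    finally show ?thesis by auto
  qed
  moreover have "\<forall>v<length ?ps. fst (?ps ! v) \<le> snd (?ps ! v)"
    using pos y(1)[of x] by (auto simp: position_def nth_append less_Suc_eq)
  moreover have "lefts (map snd ?W) = rights (map snd ?W)"
  proof -
    have "lefts ?w1 @ lefts (?w2 @ ?w3) = rights (?w1 @ ?w2) @ rights ?w3"
      using pos by (simp add: position_def)
    \<comment> \<open>By the first condition of \<open>fits\<close> both lists split at the same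
      place, which is where the new index enters each of them.\<close>
    then have "lefts ?w1 = rights (?w1 @ ?w2) \<and> lefts (?w2 @ ?w3) = rights ?w3"
      using fits by (subst (asm) append_eq_append_conv) (auto simp: fits_def)
    then show ?thesis by simp
  qed
  moreover have "length (lefts u) \<le> length (rights u) + 4" if "prefix u (map snd ?W)" for u
  proof -
    have thin: "length (lefts u) \<le> length (rights u) + 4" if "prefix u (?w1 @ ?w2 @ ?w3)" for u
      using pos that by (simp add: position_def)
    have "prefix u (?w1 @ Left ?n # ?w2 @ Right ?n # ?w3)"
      using that by simp
    then consider "prefix u ?w1" | u' where "u = ?w1 @ Left ?n # u'" "prefix u' ?w2"
      | u' where "u = ?w1 @ Left ?n # ?w2 @ Right ?n # u'" "prefix u' ?w3"
      by (auto simp: prefix_append prefix_Cons)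
    then show ?thesis
    proof cases
      case 1
      then show ?thesis by (intro thin) simp
    next
      \<comment> \<open>The new interval is open here, raising the bound from 3 to 4.\<close>
      case (2 u')
      then obtain v where "?w2 = u' @ v" by (auto simp: prefix_def)
      then have "length (lefts (?w1 @ u')) \<le> length (rights (?w1 @ u')) + 3"
        using fits unfolding fits_def by blast
      then show ?thesis by (simp add: 2)
    next
      case (3 u')
      then have "prefix (?w1 @ ?w2 @ u') (?w1 @ ?w2 @ ?w3)" by simp
      then show ?thesis using thin[of "?w1 @ ?w2 @ u'"] by (simp add: 3)
    qed
  qed
  ultimately have "position ?ps ?W"
    unfolding position_def by blast
  then show ?thesis by (rule that)
qed

text \<open>This expresses that colours are irrevocable: presenting a further interval leaves the
  earlier ones as they were.\<close>

lemma assigned_colors_snoc: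
  "assigned_colors A (Is @ [I]) = assigned_colors A Is @ [A (Is @ [I]) (assigned_colors A Is)]"
proof -
  have "prefix_colors A (Is @ [I]) n = prefix_colors A Is n" if "n \<le> length Is" for n
    using that by (induction n) auto
  then show ?thesis by (simp add: assigned_colors_def)
qed

lemma proper_assigned_colors:
  fixes G :: "nat pair_pre_digraph"
  assumes "online_coloring_algorithm A" "unit_interval_graph G" "presentation G f vs"
    and "i < length vs" "j < i" "(vs ! j, vs ! i) \<in> parcs G"
  shows "assigned_colors A (map f vs) ! i \<noteq> assigned_colors A (map f vs) ! j"
  using assms unfolding online_coloring_algorithm_def by blast

text \<open>Induction on the game. The word \<open>w\<close> is the real configuration
  \<open>W\<close> with each interval index replaced by the colour that the algorithm gave
  it.\<close>

lemma forced_seven_colors: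
  fixes A :: "'c online_algorithm"
  assumes A: "online_coloring_algorithm A" and "forced w"
  shows "position ps W \<Longrightarrow>
    map (map_endpoint ((!) (assigned_colors A (map interval ps)))) (map snd W) = w \<Longrightarrow>
    \<exists>ps' W'. position ps' W' \<and> 7 \<le> card (set (assigned_colors A (map interval ps')))"
  using assms(2)
proof (induction arbitrary: ps W)
  case (seven w)
  let ?cs = "assigned_colors A (map interval ps)"
  have "colours (map snd W) \<subseteq> {..<length ps}"
    using seven.prems(1) by (auto simp: position_def colours_def)
  then have "colours w \<subseteq> set ?cs"
    unfolding seven.prems(2)[symmetric] colours_simps(5) by (auto simp: length_assigned_colors intro!: nth_mem)
  then have "card (colours w) \<le> card (set ?cs)"
    by (intro card_mono) auto
  then show ?case using seven.hyps seven.prems(1) by (meson order_trans)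
next
  case (present w1 w2 w3)
  let ?n = "length ps"
  let ?cs = "assigned_colors A (map interval ps)"
  let ?m = "map (map_endpoint ((!) ?cs))"
  have split: "\<exists>us vs. W = us @ vs \<and> u = map f us \<and> v = map f vs" if "map f W = u @ v"
    for f :: "real \<times> nat endpoint \<Rightarrow> 'c endpoint" and W u v
    using that by (simp add: map_eq_append_conv)
  have "map (map_endpoint ((!) ?cs) \<circ> snd) W = w1 @ (w2 @ w3)"
    using present.prems(2) by simp
  then obtain W1 V where V: "W = W1 @ V" and w1: "w1 = map (map_endpoint ((!) ?cs) \<circ> snd) W1"
      and V': "w2 @ w3 = map (map_endpoint ((!) ?cs) \<circ> snd) V"
    using split by metis
  from split[OF V'[symmetric]] obtain W2 W3 where W: "V = W2 @ W3" and w23: "w2 = map (map_endpoint ((!) ?cs) \<circ> snd) W2"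
      "w3 = map (map_endpoint ((!) ?cs) \<circ> snd) W3"
    by blast
  note W = V[unfolded W]
  have w: "w1 = ?m (map snd W1)" "w2 = ?m (map snd W2)" "w3 = ?m (map snd W3)"
    by (simp_all add: w1 w23)
  have "fits (map snd W1) (map snd W2) (map snd W3)"
    using present.hyps(1) unfolding w fits_map .
  then obtain x y where
    pos: "position (ps @ [(x, y)]) (W1 @ (x, Left ?n) # W2 @ (y, Right ?n) # W3)" (is "position ?ps ?W")
    by (rule position_insert[OF present.prems(1)[unfolded W]])
  define c where "c = A (map interval ps @ [interval (x, y)]) ?cs"
  have cs: "assigned_colors A (map interval ?ps) = ?cs @ [c]"
    by (simp add: assigned_colors_snoc c_def)
  have len: "length ?cs = ?n"
    by (simp add: length_assigned_colors)
  have lt: "v < ?n" if "v \<in> colours (map snd W)" for v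
    using present.prems(1) that by (auto simp: position_def colours_def)
  \<comment> \<open>An endpoint in \<open>W2\<close> lies strictly between \<open>x\<close> and
    \<open>y\<close>, so its interval meets the new one. Correctness of the algorithm on the
    resulting graph then excludes its colour.\<close>
  have "c \<noteq> ?cs ! v" if v: "v \<in> colours (map snd W2)" for v
  proof -
    obtain z e where e: "(z, e) \<in> set W2" "colour e = v"
      using v by (auto simp: colours_def)
    have n: "v < ?n"
      using lt v by (simp add: W)
    have "z \<in> fst ` set W2" using e(1) by force
    moreover have "sorted_wrt (<) (map fst W1 @ x # map fst W2 @ y # map fst W3)"
      using pos by (simp add: position_def)
    ultimately have z: "x < z" "z < y"
      by (auto simp: sorted_wrt_append)
    have "(z, e) \<in> set W"
      using e(1) by (simp add: W)
    then have "(z, e) \<in> (\<Union>v<?n. {(fst (ps ! v), Left v), (snd (ps ! v), Right v)})"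
      using present.prems(1) by (simp only: position_def)
    then have "z = fst (ps ! v) \<or> z = snd (ps ! v)"
      using e(2) by auto
    moreover have "fst (ps ! v) \<le> snd (ps ! v)"
      using present.prems(1) n by (simp add: position_def)
    ultimately have "fst (ps ! v) \<le> y" "x \<le> snd (ps ! v)"
      using z by auto
    then have arc: "(v, ?n) \<in> parcs (intersection_graph ?ps)"
      using n by (simp add: intersection_graph_def nth_append)
    have proper: "proper_list ?ps"
      using pos by (rule position_proper_list)
    have "map (\<lambda>v. interval (?ps ! v)) [0..<length ?ps] = map interval ?ps"
      using arg_cong[OF map_nth[of ?ps], of "map interval"] by (simp only: map_map comp_def)
    moreover have "assigned_colors A (map (\<lambda>v. interval (?ps ! v)) [0..<length ?ps]) ! ?n \<noteq>
        assigned_colors A (map (\<lambda>v. interval (?ps ! v)) [0..<length ?ps]) ! v"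
    proof (rule proper_assigned_colors[OF A])
      show "unit_interval_graph (intersection_graph ?ps)"
        by (rule unit_interval_graph_intersection_graph[OF proper])
      show "presentation (intersection_graph ?ps) (\<lambda>v. interval (?ps ! v)) [0..<length ?ps]"
        by (rule presentation_intersection_graph[OF proper])
      have "[0..<m] ! i = i" if "i < m" for i m :: nat
        using that by simp
      then have "[0..<length ?ps] ! v = v" "[0..<length ?ps] ! ?n = ?n"
        using n by (simp_all del: upt_Suc)
      then show "([0..<length ?ps] ! v, [0..<length ?ps] ! ?n) \<in> parcs (intersection_graph ?ps)"
        using arc by (simp only:)
    qed (use n in simp_all)
    ultimately have "assigned_colors A (map interval ?ps) ! ?n \<noteq> assigned_colors A (map interval ?ps) ! v"
      by (simp only: not_False_eq_True)
    then show ?thesis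
      using n len unfolding cs by (simp add: nth_append)
  qed
  then have "c \<notin> colours w2"
    unfolding w colours_simps(5) by blast
  moreover have "map (map_endpoint ((!) (assigned_colors A (map interval ?ps)))) (map snd ?W) =
      w1 @ Left c # w2 @ Right c # w3"
  proof -
    \<comment> \<open>Appending \<open>c\<close> does not affect the colours at indices below
      \<open>?n\<close>.\<close>
    have "map (map_endpoint ((!) (?cs @ [c]))) (map snd V) = ?m (map snd V)" if "set V \<subseteq> set W" for V
    proof (rule map_cong[OF refl])
      fix e assume "e \<in> set (map snd V)"
      then have "colour e \<in> colours (map snd W)" using that by (auto simp: colours_def)
      then have "colour e < ?n" by (rule lt)
      then show "map_endpoint ((!) (?cs @ [c])) e = map_endpoint ((!) ?cs) e"
        using len by (cases e) (simp_all add: nth_append)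
    qed
    note old = this
    have "map (map_endpoint ((!) (?cs @ [c]))) (map snd W1) = w1"
      "map (map_endpoint ((!) (?cs @ [c]))) (map snd W2) = w2"
      "map (map_endpoint ((!) (?cs @ [c]))) (map snd W3) = w3"
      unfolding w by (rule old, force simp: W)+
    moreover have "(?cs @ [c]) ! ?n = c"
      using len by (simp add: nth_append)
    ultimately show ?thesis
      unfolding cs by (simp del: map_map)
  qed
  ultimately show ?case
    using present.IH pos by blast
qed

lemma forced_competitive_bound:
  fixes A :: "'c online_algorithm"
  assumes A: "online_coloring_algorithm A" and "forced ([] :: 'c endpoint list)" and "strictly_competitive \<rho> A"
  shows "7 / 4 \<le> \<rho>"
proof -
  have "position [] []"
    by (simp add: position_def)
  then obtain ps W where pos: "position ps W" and seven: "7 \<le> card (set (assigned_colors A (map interval ps)))"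
    using forced_seven_colors[OF assms(1,2), of "[]" "[]"] by auto
  let ?G = "intersection_graph ps"
  have proper: "proper_list ps"
    using pos by (rule position_proper_list)
  have "map (\<lambda>v. interval (ps ! v)) [0..<length ps] = map interval ps"
    using arg_cong[OF map_nth[of ps], of "map interval"] by (simp only: map_map comp_def)
  then have "card (set (assigned_colors A (map interval ps))) \<le> online_chromatic_number A ?G"
    unfolding online_chromatic_number_def
    using presentation_intersection_graph[OF proper] by (intro Max_ge[OF finite_color_counts]) force
  then have "7 \<le> \<rho> * real (chromatic_number ?G)"
    using assms(3) unit_interval_graph_intersection_graph[OF proper] seven
    unfolding strictly_competitive_def by fastforce
  \<comment> \<open>The bound 4 on the chromatic number can be multiplied by \<open>\<rho>\<close>
    only if \<open>\<rho> \<ge> 0\<close>; otherwise the product is at most 0, contradicting the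
    lower bound 7.\<close>
  moreover have "\<rho> * real (chromatic_number ?G) \<le> \<rho> * 4" if "\<rho> \<ge> 0"
    using position_chromatic_number[OF pos] that by (intro mult_left_mono) auto
  moreover have "\<rho> * real (chromatic_number ?G) \<le> 0" if "\<rho> \<le> 0"
    using that by (intro mult_nonpos_nonneg) auto
  ultimately show ?thesis by linarith
qed

theorem theorem1p1:
  fixes A :: "'c online_algorithm"
  assumes "online_coloring_algorithm A"
  shows "strict_competitive_ratio A \<ge> ereal (7 / 4)"
proof -
  \<comment> \<open>The table uses colours in \<open>nat\<close>. The empty word has no colours, so
    any map is injective on them and transfers the result to the colour type of
    \<open>A\<close>.\<close>
  have "forced (map (map_endpoint (\<lambda>_. undefined)) ([] :: nat endpoint list) :: 'c endpoint list)"
    by (rule forced_rename[OF forced_Nil]) simp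
  then show ?thesis
    unfolding strict_competitive_ratio_def
    using forced_competitive_bound[OF assms] by (intro Inf_greatest) auto
qed

end
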